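(* Let $n\ge 2$, let $z_1,\dots,z_n\in\mathbb{C}$ (not necessarily distinct), let $$p(z)=\prod_{j=1}^n(z-z_j),$$ and let $w\in\mathbb{C}$ be a critical point of $p$ (i.e. $p'(w)=0$). Then $$\operatorname{dist}(w,Z(p))\le\frac1n\min_{a\in\mathbb{C}}\sum_{j=1}^n|z_j-a|.$$ Equality holds precisely in the following two cases: (i) $|z_1-w|=\cdots=|z_n-w|$ and $\sum_{j=1}^n(z_j-w)=0$; (ii) there are $\alpha,\beta\in\mathbb{C}$ and an integer $k$ with $1\le k\le n-1$ such that $$p(z)=(z-\alpha)^k(z-\beta)^{n-k},\qquad w=\frac{(n-k)\alpha+k\beta}{n}.$$ Moreover, when $\alpha=\beta$, or when $k=n/2$, case (ii) is contained in case (i).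
   Context: $Z(p)=\{z_1,\dots,z_n\}$ denotes the set of complex zeros of $p$, and $\operatorname{dist}(w,Z(p))=\min_{1\le j\le n}|z_j-w|$. *)

theory Defs
  imports "HOL-Analysis.Analysis" "HOL-Computational_Algebra.Polynomial"
begin

definition zero_set :: "complex poly \<Rightarrow> complex set" where
  "zero_set p = {x. poly p x = 0}"

(* Meaningful for finite nonempty S, e.g. the zero set of a nonconstant polynomial. *)
definition min_dist :: "complex \<Rightarrow> complex set \<Rightarrow> real" where
  "min_dist w S = (MIN x\<in>S. cmod (x - w))"

definition equidistant_case :: "nat \<Rightarrow> (nat \<Rightarrow> complex) \<Rightarrow> complex \<Rightarrow> bool" where
  "equidistant_case n z w \<longleftrightarrow>
     (\<forall>i\<in>{1..n}. \<forall>j\<in>{1..n}. cmod (z i - w) = cmod (z j - w)) \<and>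
     (\<Sum>j=1..n. z j - w) = 0"

definition two_point_case ::
    "nat \<Rightarrow> complex poly \<Rightarrow> complex \<Rightarrow> complex \<Rightarrow> complex \<Rightarrow> nat \<Rightarrow> bool" where
  "two_point_case n p w \<alpha> \<beta> k \<longleftrightarrow>
     1 \<le> k \<and> k \<le> n - 1 \<and>
     p = [:- \<alpha>, 1:] ^ k * [:- \<beta>, 1:] ^ (n - k) \<and>
     w = (of_nat (n - k) * \<alpha> + of_nat k * \<beta>) / of_nat n"

end

theory Submission
  imports Defs
begin

text \<open>
  Put \<open>u\<^sub>j = z\<^sub>j - w\<close> and let \<open>d\<close> be the least modulus of the \<open>u\<^sub>j\<close>, which we may assume positive.
  That \<open>w\<close> is critical means \<open>\<Sum> 1 / u\<^sub>j = 0\<close>, so the weights \<open>c\<^sub>j = d / u\<^sub>j\<close> satisfy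
  \<open>\<bar>c\<^sub>j\<bar> \<le> 1\<close>, \<open>\<Sum> c\<^sub>j = 0\<close> and \<open>\<Sum> c\<^sub>j u\<^sub>j = n d\<close>. Hence
  \<open>n d = \<Sum> c\<^sub>j (u\<^sub>j - a) \<le> \<Sum> \<bar>u\<^sub>j - a\<bar>\<close> for every \<open>a\<close>. Equality forces, for each \<open>j\<close>, that
  \<open>u\<^sub>j = a\<close> or that \<open>\<bar>u\<^sub>j\<bar> = d\<close> and \<open>(u\<^sub>j - a) / u\<^sub>j\<close> is a nonnegative real; if some \<open>u\<^sub>j\<close>
  equals \<open>a\<close>, then \<open>\<bar>a\<bar> \<ge> d\<close> and the others can only be \<open>- (d / \<bar>a\<bar>) a\<close>.
\<close>

section \<open>Optimal centres and the critical point equation\<close>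

text \<open>A single term \<open>norm (z i - a)\<close> already bounds the sum from below, so
  outside the closed ball about \<open>z i\<close> whose radius is the sum at \<open>z i\<close>,
  the sum exceeds its value at \<open>z i\<close>. On the ball, compactness yields a
  minimum.\<close>

lemma sum_dist_attains_min:
  fixes z :: "'i \<Rightarrow> 'a::{real_normed_vector,heine_borel}"
  assumes "finite A"
  shows "\<exists>a. \<forall>b. (\<Sum>j\<in>A. norm (z j - a)) \<le> (\<Sum>j\<in>A. norm (z j - b))"
proof (cases "A = {}")
  case False
  then obtain i where i: "i \<in> A" by blast
  define g where "g = (\<lambda>a. \<Sum>j\<in>A. norm (z j - a))"
  have g_ge: "norm (z i - a) \<le> g a" for a
    unfolding g_def using assms i by (intro member_le_sum) auto
  have "g (z i) \<ge> 0" by (simp add: g_def sum_nonneg)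
  then have centre: "z i \<in> cball (z i) (g (z i))" by simp
  have "continuous_on (cball (z i) (g (z i))) g"
    unfolding g_def by (intro continuous_intros)
  with centre obtain a where a: "\<And>b. b \<in> cball (z i) (g (z i)) \<Longrightarrow> g a \<le> g b"
    using continuous_attains_inf[of "cball (z i) (g (z i))" g] compact_cball by blast
  have "g a \<le> g b" for b
  proof (cases "b \<in> cball (z i) (g (z i))")
    case False
    then have "g (z i) < norm (z i - b)" by (simp add: dist_norm)
    then show ?thesis using g_ge[of b] a[OF centre] by linarith
  qed (rule a)
  then show ?thesis unfolding g_def by blast
qed simp

text \<open>The product rule writes the derivative at \<open>w\<close> as the sum of the products
  with one factor left out. Dividing by the nonzero value \<open>P\<close> of the polynomial at
  \<open>w\<close> gives, up to sign, the sum of reciprocals.\<close>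

lemma sum_inverse_eq_0_if_critical:
  fixes z :: "'i \<Rightarrow> 'a::field"
  assumes "finite A" and "poly (pderiv (\<Prod>j\<in>A. [:- z j, 1:])) w = 0"
    and "\<And>j. j \<in> A \<Longrightarrow> z j \<noteq> w"
  shows "(\<Sum>j\<in>A. 1 / (z j - w)) = 0"
proof -
  define P where "P = (\<Prod>j\<in>A. w - z j)"
  have P: "P \<noteq> 0" using assms(1,3) by (auto simp: P_def)
  have "0 = (\<Sum>a\<in>A. \<Prod>j\<in>A - {a}. w - z j)"
    using assms(2) by (simp add: pderiv_prod poly_sum poly_prod pderiv_pCons)
  also have "\<dots> = (\<Sum>a\<in>A. - P * (1 / (z a - w)))"
  proof (rule sum.cong[OF refl])
    fix a assume a: "a \<in> A"
    have "P = (w - z a) * (\<Prod>j\<in>A - {a}. w - z j)"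
      unfolding P_def using assms(1) a by (rule prod.remove)
    then show "(\<Prod>j\<in>A - {a}. w - z j) = - P * (1 / (z a - w))"
      using assms(3)[OF a] by (simp add: field_simps)
  qed
  also have "\<dots> = - P * (\<Sum>a\<in>A. 1 / (z a - w))"
    by (simp only: sum_distrib_left)
  finally show ?thesis using P by simp
qed

section \<open>The weighted bound and its equality condition\<close>

lemma Re_weight_le:
  assumes "u \<noteq> 0" "0 \<le> d" "d \<le> cmod u"
  shows "Re (of_real d / u * (u - a)) \<le> cmod (u - a)"
proof -
  have "Re (of_real d / u * (u - a)) \<le> cmod (of_real d / u * (u - a))"
    by (rule complex_Re_le_cmod)
  also have "\<dots> = d / cmod u * cmod (u - a)"
    using assms by (simp add: norm_mult norm_divide)
  also have "\<dots> \<le> 1 * cmod (u - a)"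
    using assms by (intro mult_right_mono) auto
  finally show ?thesis by simp
qed

text \<open>The weights \<open>d / u j\<close> sum to zero, so the shift by \<open>a\<close> drops
  out, and each weight times \<open>u j\<close> is \<open>d\<close>.\<close>

lemma sum_Re_weight:
  assumes "finite A" "\<And>j. j \<in> A \<Longrightarrow> u j \<noteq> 0" "(\<Sum>j\<in>A. 1 / u j) = 0"
  shows "(\<Sum>j\<in>A. Re (of_real d / u j * (u j - a))) = real (card A) * d"
proof -
  have "(\<Sum>j\<in>A. of_real d / u j * (u j - a)) = (\<Sum>j\<in>A. of_real d - of_real d * a * (1 / u j))"
    using assms(2) by (intro sum.cong) (auto simp: field_simps)
  also have "\<dots> = of_real (real (card A) * d) - of_real d * a * (\<Sum>j\<in>A. 1 / u j)"
    by (simp only: sum_subtractf sum_distrib_left) simp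
  finally have "(\<Sum>j\<in>A. of_real d / u j * (u j - a)) = of_real (real (card A) * d)"
    using assms(3) by simp
  then have "Re (\<Sum>j\<in>A. of_real d / u j * (u j - a)) = real (card A) * d"
    by (simp only: Re_complex_of_real)
  then show ?thesis by (simp only: Re_sum)
qed

lemma card_mult_min_norm_le_sum_dist:
  assumes "finite A" "\<And>j. j \<in> A \<Longrightarrow> u j \<noteq> 0" "(\<Sum>j\<in>A. 1 / u j) = 0"
    and "0 \<le> d" "\<And>j. j \<in> A \<Longrightarrow> d \<le> cmod (u j)"
  shows "real (card A) * d \<le> (\<Sum>j\<in>A. cmod (u j - a))"
  using sum_mono[of A "\<lambda>j. Re (of_real d / u j * (u j - a))" "\<lambda>j. cmod (u j - a)"]
    Re_weight_le sum_Re_weight[OF assms(1-3), of d a] assms(2,4,5) by simp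

text \<open>With \<open>q = (u - a) / u\<close>, equality reads
  \<open>d * Re q = cmod u * cmod q\<close>. Since \<open>Re q \<le> cmod q\<close> and
  \<open>d \<le> cmod u\<close>, both must be equalities, so \<open>q\<close> is a positive real and
  \<open>a = (1 - q) * u\<close> lies on the real line through 0 and \<open>u\<close>.\<close>

lemma Re_weight_eq_imp:
  assumes "u \<noteq> 0" "0 < d" "d \<le> cmod u" "u \<noteq> a"
    and eq: "Re (of_real d / u * (u - a)) = cmod (u - a)"
  shows "cmod u = d" and "d \<le> cmod a \<Longrightarrow> u = - of_real (d / cmod a) * a"
proof -
  define q where "q = (u - a) / u"
  have q0: "cmod q > 0" using assms(1,4) by (simp add: q_def)
  have ua: "u - a = u * q" using assms(1) by (simp add: q_def)
  have "Re (of_real d / u * (u - a)) = Re (of_real d * q)"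
    by (simp add: q_def)
  then have eq': "d * Re q = cmod u * cmod q"
    using eq ua by (simp add: norm_mult)
  have "d * Re q \<le> d * cmod q" using assms(2) by (simp add: complex_Re_le_cmod)
  then have "cmod u * cmod q \<le> d * cmod q" using eq' by simp
  then show ud: "cmod u = d" using q0 assms(3) by simp
  assume "d \<le> cmod a"
  have "Re q = cmod q" using eq' ud assms(2) by simp
  then have q: "q = of_real (cmod q)"
    using cmod_power2[of q] by (simp add: complex_eq_iff)
  have a: "a = of_real (1 - cmod q) * u"
    using ua q by (simp add: algebra_simps)
  then have na: "cmod a = \<bar>1 - cmod q\<bar> * d"
    using ud by (metis norm_mult norm_of_real)
  then have "1 \<le> \<bar>1 - cmod q\<bar>"
    using \<open>d \<le> cmod a\<close> assms(2) by simp
  \<comment> \<open>The alternative \<open>1 - cmod q \<ge> 1\<close> fails because \<open>q\<close>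
    is nonzero. Hence \<open>a\<close> lies on the opposite side of 0 from \<open>u\<close>.\<close>
  then have q2: "cmod q \<ge> 2" using q0 by linarith
  then have r: "d / cmod a = 1 / (cmod q - 1)"
    using na assms(2) by simp
  have "of_real (d / cmod a) * a = of_real (1 / (cmod q - 1) * (1 - cmod q)) * u"
    unfolding r by (subst (1) a) (simp only: of_real_mult mult.assoc)
  also have "1 / (cmod q - 1) * (1 - cmod q) = -1"
    using q2 by (simp add: field_simps)
  finally show "u = - of_real (d / cmod a) * a" by simp
qed

section \<open>Configurations that attain equality\<close>

lemma sum_eq_sum_mset_proots:
  assumes "finite A"
  shows "(\<Sum>j\<in>A. f (z j)) = (\<Sum>x\<in>#proots (\<Prod>j\<in>A. [:- z j, 1:]). f x)"
proof -
  have "proots (\<Prod>j\<in>A. [:- z j, 1:]) = (\<Sum>j\<in>A. {#z j#})"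
    by (subst proots_prod) auto
  also have "\<dots> = image_mset z (mset_set A)"
    using assms by (induction A rule: finite_induct) auto
  finally show ?thesis
    by (simp add: sum_unfold_sum_mset multiset.map_comp comp_def)
qed

text \<open>The two-point case fixes the polynomial, not the indexing of its zeros. Comparing the
  root multisets of both factorisations counts \<open>k\<close> copies of \<alpha> and
  \<open>n - k\<close> of \<beta>, also when \<alpha> = \<beta>.\<close>

lemma two_point_sum:
  fixes f :: "complex \<Rightarrow> 'b::comm_semiring_1"
  assumes "two_point_case n (\<Prod>j=1..n. [:- z j, 1:]) w \<alpha> \<beta> k"
  shows "(\<Sum>j=1..n. f (z j)) = of_nat k * f \<alpha> + of_nat (n - k) * f \<beta>"
proof -
  have p: "(\<Prod>j=1..n. [:- z j, 1:]) = [:- \<alpha>, 1:] ^ k * [:- \<beta>, 1:] ^ (n - k)"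
    using assms by (simp add: two_point_case_def)
  have *: "(\<Sum>x\<in>#replicate_mset m a. f x) = of_nat m * f a" for m a
    by (induction m) (auto simp: algebra_simps)
  have "proots ([:- \<alpha>, 1:] ^ k * [:- \<beta>, 1:] ^ (n - k)) =
      replicate_mset k \<alpha> + replicate_mset (n - k) \<beta>"
    by (simp add: proots_mult proots_power)
  then show ?thesis
    using sum_eq_sum_mset_proots[of "{1..n}" f z] unfolding p by (simp add: *)
qed

lemma zero_set_prod:
  assumes "finite A"
  shows "zero_set (\<Prod>j\<in>A. [:- z j, 1:]) = z ` A"
  using assms by (auto simp: zero_set_def poly_prod)

lemma two_point_zero_set:
  assumes "two_point_case n p w \<alpha> \<beta> k"
  shows "zero_set p = {\<alpha>, \<beta>}"
  using assms by (auto simp: zero_set_def two_point_case_def)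

text \<open>The right-hand sides are the sums of the distances from all zeros, with multiplicity, to
  \<beta> and to \<alpha> respectively.\<close>

lemma two_point_diff:
  assumes "two_point_case n p w \<alpha> \<beta> k"
  shows "real n * cmod (\<alpha> - w) = real k * cmod (\<alpha> - \<beta>)"
    and "real n * cmod (\<beta> - w) = real (n - k) * cmod (\<alpha> - \<beta>)"
proof -
  have k: "1 \<le> k" "k \<le> n - 1" and w: "w = (of_nat (n - k) * \<alpha> + of_nat k * \<beta>) / of_nat n"
    using assms by (auto simp: two_point_case_def)
  then have "n > 0" by simp
  then have nw: "of_nat n * w = of_nat (n - k) * \<alpha> + of_nat k * \<beta>" using w by simp
  have n: "(of_nat n :: complex) = of_nat (n - k) + of_nat k"
    using k by (simp flip: of_nat_add)
  have "of_nat n * (\<alpha> - w) = of_nat k * (\<alpha> - \<beta>)"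
    using nw by (simp add: right_diff_distrib) (simp add: n algebra_simps)
  then show "real n * cmod (\<alpha> - w) = real k * cmod (\<alpha> - \<beta>)"
    by (metis norm_mult norm_of_nat)
  have "of_nat n * (\<beta> - w) = of_nat (n - k) * (\<beta> - \<alpha>)"
    using nw by (simp add: right_diff_distrib) (simp add: n algebra_simps)
  then show "real n * cmod (\<beta> - w) = real (n - k) * cmod (\<alpha> - \<beta>)"
    by (metis norm_mult norm_of_nat norm_minus_commute)
qed

lemma min_dist_prod:
  assumes "finite A" "A \<noteq> {}"
  shows "\<And>j. j \<in> A \<Longrightarrow> min_dist w (zero_set (\<Prod>j\<in>A. [:- z j, 1:])) \<le> cmod (z j - w)"
    and "\<exists>j\<in>A. min_dist w (zero_set (\<Prod>j\<in>A. [:- z j, 1:])) = cmod (z j - w)"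
proof -
  have eq: "min_dist w (zero_set (\<Prod>j\<in>A. [:- z j, 1:])) = Min ((\<lambda>j. cmod (z j - w)) ` A)"
    by (simp add: min_dist_def zero_set_prod[OF assms(1)] image_image)
  show "\<And>j. j \<in> A \<Longrightarrow> min_dist w (zero_set (\<Prod>j\<in>A. [:- z j, 1:])) \<le> cmod (z j - w)"
    using assms by (simp add: eq)
  show "\<exists>j\<in>A. min_dist w (zero_set (\<Prod>j\<in>A. [:- z j, 1:])) = cmod (z j - w)"
    using Min_in[of "(\<lambda>j. cmod (z j - w)) ` A"] assms unfolding eq by fastforce
qed

text \<open>If \<alpha> = \<beta>, all zeros coincide with \<open>w\<close>; if
  \<open>k = n / 2\<close>, then \<open>w\<close> is the midpoint of two zeros of equal
  multiplicity.\<close>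

lemma two_point_equidistant:
  assumes "two_point_case n (\<Prod>j=1..n. [:- z j, 1:]) w \<alpha> \<beta> k"
    and "\<alpha> = \<beta> \<or> real k = real n / 2"
  shows "equidistant_case n z w"
proof -
  have k: "1 \<le> k" "k \<le> n - 1" and w: "w = (of_nat (n - k) * \<alpha> + of_nat k * \<beta>) / of_nat n"
    using assms(1) by (auto simp: two_point_case_def)
  then have n: "n > 0" by simp
  have z: "z j \<in> {\<alpha>, \<beta>}" if "j \<in> {1..n}" for j
    using two_point_zero_set[OF assms(1)] that by (auto simp: zero_set_prod)
  have k2: "n = 2 * k" if "\<alpha> \<noteq> \<beta>"
  proof -
    have "real n = real (2 * k)" using assms(2) that by simp
    then show ?thesis by (simp only: of_nat_eq_iff)
  qed
  then have "real k * cmod (\<alpha> - \<beta>) = real (n - k) * cmod (\<alpha> - \<beta>)"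
    by (cases "\<alpha> = \<beta>") auto
  then have "cmod (\<alpha> - w) = cmod (\<beta> - w)"
    using two_point_diff[OF assms(1)] n by (metis mult_cancel_left of_nat_0_eq_iff less_irrefl)
  then have "cmod (z j - w) = cmod (\<alpha> - w)" if "j \<in> {1..n}" for j
    using z[OF that] by auto
  moreover have "(\<Sum>j=1..n. z j - w) = 0"
  proof -
    have "of_nat n * w = of_nat (n - k) * \<alpha> + of_nat k * \<beta>" using w n by simp
    also have "\<dots> = of_nat k * \<alpha> + of_nat (n - k) * \<beta>"
      using k2 by (cases "\<alpha> = \<beta>") (auto simp: algebra_simps)
    finally show ?thesis
      using two_point_sum[OF assms(1), of "\<lambda>x. x"] by (simp add: sum_subtractf)
  qed
  ultimately show ?thesis by (auto simp: equidistant_case_def)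
qed

text \<open>The centre is the zero other than the one realising the distance from \<open>w\<close>:
  for \<open>a = \<beta>\<close> the sum is \<open>k * cmod (\<alpha> - \<beta>)\<close>, which
  equals \<open>n * cmod (\<alpha> - w)\<close>.\<close>

lemma two_point_sum_dist_le:
  assumes "two_point_case n (\<Prod>j=1..n. [:- z j, 1:]) w \<alpha> \<beta> k"
  shows "\<exists>a. (\<Sum>j=1..n. cmod (z j - a)) \<le>
    real n * min_dist w (zero_set (\<Prod>j=1..n. [:- z j, 1:]))"
proof -
  let ?d = "min_dist w (zero_set (\<Prod>j=1..n. [:- z j, 1:]))"
  have "?d = min (cmod (\<alpha> - w)) (cmod (\<beta> - w))"
    unfolding two_point_zero_set[OF assms] by (simp add: min_dist_def)
  then consider "?d = cmod (\<alpha> - w)" | "?d = cmod (\<beta> - w)" by linarith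
  then show ?thesis
  proof cases
    case 1
    then show ?thesis
      using two_point_sum[OF assms, of "\<lambda>x. cmod (x - \<beta>)"] two_point_diff(1)[OF assms]
      by (intro exI[of _ \<beta>]) simp
  next
    case 2
    then show ?thesis
      using two_point_sum[OF assms, of "\<lambda>x. cmod (x - \<alpha>)"] two_point_diff(2)[OF assms]
      by (intro exI[of _ \<alpha>]) (simp add: norm_minus_commute)
  qed
qed

lemma equidistant_sum_dist_le:
  assumes "equidistant_case n z w" "n \<ge> 1"
  shows "(\<Sum>j=1..n. cmod (z j - w)) \<le>
    real n * min_dist w (zero_set (\<Prod>j=1..n. [:- z j, 1:]))"
proof -
  obtain i where i: "i \<in> {1..n}" "min_dist w (zero_set (\<Prod>j=1..n. [:- z j, 1:])) = cmod (z i - w)"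
    using min_dist_prod(2)[of "{1..n}" w z] assms(2) by auto
  have "(\<Sum>j=1..n. cmod (z j - w)) = (\<Sum>j=1..n. cmod (z i - w))"
    using assms(1) i(1) unfolding equidistant_case_def by (intro sum.cong) blast+
  then show ?thesis using i(2) by simp
qed

section \<open>From equality to the two configurations\<close>

lemma equality_cases:
  fixes z :: "nat \<Rightarrow> complex"
  assumes n: "n \<ge> 1" and nz: "\<And>j. j \<in> {1..n} \<Longrightarrow> z j \<noteq> w"
    and inv: "(\<Sum>j=1..n. 1 / (z j - w)) = 0"
    and d: "0 < d" "\<And>j. j \<in> {1..n} \<Longrightarrow> d \<le> cmod (z j - w)"
    and eq: "real n * d = (\<Sum>j=1..n. cmod (z j - (w + a)))"
  shows "equidistant_case n z w \<or> (\<exists>\<alpha> \<beta> k. two_point_case n (\<Prod>j=1..n. [:- z j, 1:]) w \<alpha> \<beta> k)"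
proof -
  define u where "u j = z j - w" for j
  have u0: "u j \<noteq> 0" and du: "d \<le> cmod (u j)" if "j \<in> {1..n}" for j
    using nz[OF that] d(2)[OF that] by (auto simp: u_def)
  have inv': "(\<Sum>j=1..n. 1 / u j) = 0" using inv by (simp add: u_def)
  have "(\<Sum>j=1..n. Re (of_real d / u j * (u j - a))) = (\<Sum>j=1..n. cmod (u j - a))"
    using sum_Re_weight[of "{1..n}" u d a] u0 inv' eq by (simp add: u_def algebra_simps)
  \<comment> \<open>Termwise domination together with equal sums forces equality in every
    term.\<close>
  then have tight: "Re (of_real d / u j * (u j - a)) = cmod (u j - a)" if "j \<in> {1..n}" for j
    using sum_mono_inv[of "\<lambda>j. Re (of_real d / u j * (u j - a))" "{1..n}" "\<lambda>j. cmod (u j - a)" j]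
      Re_weight_le u0 du d(1) that by simp
  define K where "K = {j\<in>{1..n}. u j = a}"
  have norm_u: "cmod (u j) = d" if "j \<in> {1..n} - K" for j
    using Re_weight_eq_imp(1)[of "u j" d a] that u0 du d(1) tight by (auto simp: K_def)
  show ?thesis
  proof (cases "K = {}")
    case True
    \<comment> \<open>No zero sits at the centre, so all \<open>u j\<close> lie on the circle of
      radius \<open>d\<close>. There inversion is conjugation up to scaling, and the vanishing sum
      of reciprocals becomes a vanishing sum of the \<open>u j\<close>.\<close>
    have "1 / u j = cnj (u j) / of_real (d\<^sup>2)" if "j \<in> {1..n}" for j
    proof -
      have "u j * cnj (u j) = of_real (d\<^sup>2)"
        using norm_u[of j] that True by (simp flip: complex_norm_square)
      then show ?thesis using u0[OF that] d(1) by (simp add: field_simps)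
    qed
    then have "(\<Sum>j=1..n. cnj (u j) / of_real (d\<^sup>2)) = 0"
      using inv' by simp
    then have "(\<Sum>j=1..n. cnj (u j)) = 0"
      using d(1) by (simp flip: sum_divide_distrib)
    then have "(\<Sum>j=1..n. u j) = 0" by (simp flip: cnj_sum)
    then have "equidistant_case n z w"
      using norm_u True by (simp add: equidistant_case_def u_def)
    then show ?thesis ..
  next
    case False
    then obtain i where i: "i \<in> {1..n}" "u i = a" by (auto simp: K_def)
    \<comment> \<open>Being one of the \<open>u j\<close>, the centre \<open>a\<close> has modulus
      at least \<open>d\<close>, which puts every remaining \<open>u j\<close> at the single point
      \<open>b\<close>.\<close>
    then have a0: "a \<noteq> 0" and da: "d \<le> cmod a" using u0 du by auto
    define b where "b = - of_real (d / cmod a) * a"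
    have b0: "b \<noteq> 0" using a0 d(1) by (simp add: b_def)
    have ub: "u j = b" if "j \<in> {1..n} - K" for j
      unfolding b_def using Re_weight_eq_imp(2)[of "u j" d a] that u0 du d(1) tight da
      by (auto simp: K_def)
    define k where "k = card K"
    have K: "K \<subseteq> {1..n}" "finite K" by (auto simp: K_def)
    have cardC: "card ({1..n} - K) = n - k" using K by (simp add: card_Diff_subset k_def)
    have kn: "k \<le> n" using card_mono[OF _ K(1)] by (simp add: k_def)
    have split: "(\<Sum>j=1..n. 1 / u j) = of_nat k / a + of_nat (n - k) / b"
    proof -
      have "(\<Sum>j=1..n. 1 / u j) = (\<Sum>j\<in>{1..n} - K. 1 / u j) + (\<Sum>j\<in>K. 1 / u j)"
        using K by (intro sum.subset_diff) auto
      also have "(\<Sum>j\<in>K. 1 / u j) = (\<Sum>j\<in>K. 1 / a)"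
        by (intro sum.cong) (auto simp: K_def)
      also have "(\<Sum>j\<in>{1..n} - K. 1 / u j) = (\<Sum>j\<in>{1..n} - K. 1 / b)"
        using ub by (intro sum.cong) auto
      finally show ?thesis by (simp only: sum_constant cardC flip: k_def) (simp add: add.commute)
    qed
    have k1: "1 \<le> k" using False K by (simp add: k_def Suc_le_eq card_gt_0_iff)
    \<comment> \<open>If all \<open>u j\<close> equalled \<open>a\<close>, their reciprocals would
      sum to \<open>n / a\<close>, which is nonzero.\<close>
    have "k \<noteq> n"
      using split inv' a0 n by auto
    then have k2: "k \<le> n - 1" using kn by simp
    \<comment> \<open>Clearing denominators swaps the multiplicities, which is why \<open>k\<close>
      goes with \<beta> in the formula for \<open>w\<close>.\<close>
    have balance: "of_nat (n - k) * a + of_nat k * b = 0"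
      using split inv' a0 b0 by (simp add: field_simps)
    have "(\<Prod>j=1..n. [:- z j, 1:]) = (\<Prod>j\<in>{1..n} - K. [:- z j, 1:]) * (\<Prod>j\<in>K. [:- z j, 1:])"
      using K by (intro prod.subset_diff) auto
    also have "(\<Prod>j\<in>K. [:- z j, 1:]) = (\<Prod>j\<in>K. [:- (w + a), 1:])"
      by (intro prod.cong) (auto simp: K_def u_def)
    also have "(\<Prod>j\<in>{1..n} - K. [:- z j, 1:]) = (\<Prod>j\<in>{1..n} - K. [:- (w + b), 1:])"
      using ub by (intro prod.cong) (auto simp: u_def algebra_simps)
    finally have p: "(\<Prod>j=1..n. [:- z j, 1:]) = [:- (w + a), 1:] ^ k * [:- (w + b), 1:] ^ (n - k)"
      by (simp only: prod_constant cardC mult.commute flip: k_def)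
    have "of_nat (n - k) * (w + a) + of_nat k * (w + b) = of_nat (n - k + k) * w"
      using balance unfolding of_nat_add by (simp add: algebra_simps)
    then have "w = (of_nat (n - k) * (w + a) + of_nat k * (w + b)) / of_nat n"
      using kn n by simp
    then have "two_point_case n (\<Prod>j=1..n. [:- z j, 1:]) w (w + a) (w + b) k"
      using k1 k2 p by (simp only: two_point_case_def simp_thms)
    then show ?thesis by blast
  qed
qed

theorem proposition2:
  fixes n :: nat and z :: "nat \<Rightarrow> complex" and p :: "complex poly" and w :: complex
  assumes "n \<ge> 2"
    and "p = (\<Prod>j=1..n. [:- z j, 1:])"
    and "poly (pderiv p) w = 0"
  shows "(\<exists>a. \<forall>b. (\<Sum>j=1..n. cmod (z j - a)) \<le> (\<Sum>j=1..n. cmod (z j - b))) \<and>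
    min_dist w (zero_set p) \<le> 1 / real n * (INF a. \<Sum>j=1..n. cmod (z j - a)) \<and>
    (min_dist w (zero_set p) = 1 / real n * (INF a. \<Sum>j=1..n. cmod (z j - a)) \<longleftrightarrow>
       equidistant_case n z w \<or> (\<exists>\<alpha> \<beta> k. two_point_case n p w \<alpha> \<beta> k)) \<and>
    (\<forall>\<alpha> \<beta> k. two_point_case n p w \<alpha> \<beta> k \<and> (\<alpha> = \<beta> \<or> real k = real n / 2) \<longrightarrow>
       equidistant_case n z w)"
proof -
  define g where "g a = (\<Sum>j=1..n. cmod (z j - a))" for a
  define d where "d = min_dist w (zero_set p)"
  note p = assms(2)
  have n: "n \<ge> 1" "{1..n} \<noteq> {}" using assms(1) by auto
  obtain m where m: "\<And>b. g m \<le> g b"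
    using sum_dist_attains_min[of "{1..n}" z] by (auto simp: g_def)
  have INF: "(INF a. g a) = g m"
    using m by (intro cInf_eq_minimum) auto
  have dle: "d \<le> cmod (z j - w)" if "j \<in> {1..n}" for j
    unfolding d_def p using n that by (intro min_dist_prod(1)) auto
  obtain i where i: "i \<in> {1..n}" "d = cmod (z i - w)"
    using min_dist_prod(2)[of "{1..n}" w z] n by (auto simp: d_def p)
  have main: "real n * d \<le> g m \<and> (real n * d = g m \<longrightarrow>
      equidistant_case n z w \<or> (\<exists>\<alpha> \<beta> k. two_point_case n p w \<alpha> \<beta> k))"
  proof (cases "d = 0")
    case True
    have "equidistant_case n z w" if "g m = 0"
    proof -
      have "z j = m" if "j \<in> {1..n}" for j
        using \<open>g m = 0\<close> that by (simp add: g_def sum_nonneg_eq_0_iff)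
      moreover from this have "w = m" using i True by simp
      ultimately show ?thesis by (simp add: equidistant_case_def)
    qed
    moreover have "0 \<le> g m" by (simp add: g_def sum_nonneg)
    ultimately show ?thesis using True by simp
  next
    case False
    then have d0: "0 < d" using i by simp
    have nz: "z j \<noteq> w" if "j \<in> {1..n}" for j using dle[OF that] d0 by auto
    have inv: "(\<Sum>j=1..n. 1 / (z j - w)) = 0"
      using assms(3) nz unfolding p by (intro sum_inverse_eq_0_if_critical) auto
    have "real n * d \<le> g m"
      using card_mult_min_norm_le_sum_dist[of "{1..n}" "\<lambda>j. z j - w" d "m - w"] nz inv d0 dle
      by (simp add: g_def)
    then show ?thesis
      using equality_cases[OF n(1) nz inv d0 dle, of "m - w"] by (simp add: g_def p)
  qed
  \<comment> \<open>As \<open>g m\<close> is the minimum, one centre with value at most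
    \<open>n * d\<close> suffices; \<open>main\<close> supplies the opposite inequality.\<close>
  have conv: "g m \<le> real n * d"
    if "equidistant_case n z w \<or> (\<exists>\<alpha> \<beta> k. two_point_case n p w \<alpha> \<beta> k)"
  proof -
    have "\<exists>a. g a \<le> real n * d"
      using that equidistant_sum_dist_le[of n z w] two_point_sum_dist_le[of n z w] n(1)
      unfolding g_def d_def p by blast
    then show ?thesis using m order_trans by blast
  qed
  have "d \<le> 1 / real n * g m \<longleftrightarrow> real n * d \<le> g m"
    and "d = 1 / real n * g m \<longleftrightarrow> real n * d = g m"
    using n(1) by (auto simp: field_simps)
  then have "d \<le> 1 / real n * g m \<and> (d = 1 / real n * g m \<longleftrightarrow>
      equidistant_case n z w \<or> (\<exists>\<alpha> \<beta> k. two_point_case n p w \<alpha> \<beta> k))"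
    using main conv by (metis order_antisym)
  moreover have "\<exists>a. \<forall>b. g a \<le> g b" using m by blast
  moreover have "\<forall>\<alpha> \<beta> k. two_point_case n p w \<alpha> \<beta> k \<and> (\<alpha> = \<beta> \<or> real k = real n / 2) \<longrightarrow>
      equidistant_case n z w"
    using two_point_equidistant unfolding p by blast
  ultimately show ?thesis
    unfolding INF[symmetric] unfolding g_def d_def by blast
qed

end
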